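(* Let $H$ be a complex Hilbert space, let $A\in\mathcal{B}(H)$ and $B\in\mathcal{B}(\ell^2)$ be positive, and let $F=\{f_n\}_{n\in\mathbb{N}}\subset H$ be a sequence. The following conditions are equivalent. (1) $F$ is an $AB$-frame. (2) $\mathcal{D}(C_{AB})=H$, $B^{1/2}C_{AB}\in\mathcal{B}(H,\ell^2)$, and $\mathcal{R}\bigl((B^{1/2}C_{AB})^*\bigr)=\mathcal{R}(A^{1/2})$.
   Context: $\ell^2=\ell^2(\mathbb{N})$ is the complex Hilbert space of square-summable sequences; inner products are linear in the first variable; $\langle f,g\rangle_A=\langle Af,g\rangle$, $\|f\|_A=\langle Af,f\rangle^{1/2}$ on $H$ and $\|c\|_B=\langle Bc,c\rangle^{1/2}$ on $\ell^2$. $\mathcal{D}$ and $\mathcal{R}$ denote domain and range. The $AB$-analysis operator is $C_{AB}f=\{\langle f,f_n\rangle_A\}_{n\in\mathbb{N}}$ with $\mathcal{D}(C_{AB})=\{f\in H:\{\langle f,f_n\rangle_A\}_n\in\ell^2\}$. $F$ is an $AB$-frame if $\mathcal{D}(C_{AB})=H$ and there are constants $\alpha,\beta>0$ with $\alpha\|f\|_A^2\le\|C_{AB}f\|_B^2\le\beta\|f\|_A^2$ for all $f\in H$. *)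

theory Defs
  imports "HOL-Analysis.Analysis"
begin

section \<open>Complex Hilbert spaces\<close>

text \<open>
  A complex inner product is linear in the first variable.  The class extends
  \<^class>\<open>real_inner\<close>, whose real inner product is required to be the real part of the complex one;
  in particular \<^prop>\<open>norm x = sqrt (inner x x)\<close> is the norm induced by the complex inner product.
\<close>

class complex_inner = real_inner +
  fixes scaleC :: "complex \<Rightarrow> 'a \<Rightarrow> 'a" (infixr "*\<^sub>C" 75)
    and cinner :: "'a \<Rightarrow> 'a \<Rightarrow> complex"
  assumes scaleC_add_right: "c *\<^sub>C (x + y) = c *\<^sub>C x + c *\<^sub>C y"
    and scaleC_add_left: "(c + d) *\<^sub>C x = c *\<^sub>C x + d *\<^sub>C x"
    and scaleC_scaleC: "c *\<^sub>C (d *\<^sub>C x) = (c * d) *\<^sub>C x"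
    and scaleC_of_real: "complex_of_real r *\<^sub>C x = scaleR r x"
    and cinner_commute: "cinner x y = cnj (cinner y x)"
    and cinner_add_left: "cinner (x + y) z = cinner x z + cinner y z"
    and cinner_scaleC_left: "cinner (c *\<^sub>C x) y = c * cinner x y"
    and inner_eq_Re_cinner: "inner x y = Re (cinner x y)"

class chilbert_space = complex_inner + complete_space

subclass (in chilbert_space) banach ..

lemma scaleC_one: "1 *\<^sub>C x = (x :: 'a::complex_inner)"
  using scaleC_of_real[of 1 x] by simp

lemma cinner_self: "cinner x x = complex_of_real ((norm x)\<^sup>2)" for x :: "'a::complex_inner"
proof (rule complex_eqI)
  show "Re (cinner x x) = Re (complex_of_real ((norm x)\<^sup>2))"
    by (simp add: power2_norm_eq_inner inner_eq_Re_cinner)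
  have "Im (cinner x x) = - Im (cinner x x)"
    using cinner_commute[of x x] by (metis cnj.simps(2))
  then show "Im (cinner x x) = Im (complex_of_real ((norm x)\<^sup>2))"
    by simp
qed


section \<open>The Hilbert space of square-summable complex sequences\<close>

definition square_summable :: "(nat \<Rightarrow> complex) \<Rightarrow> bool"
  where "square_summable c \<longleftrightarrow> summable (\<lambda>n. (cmod (c n))\<^sup>2)"

typedef ell2 = "{c. square_summable c}"
  morphisms ell2_nth Abs_ell2
  by (rule exI[of _ "\<lambda>_. 0"]) (simp add: square_summable_def)

lemma ell2_eqI: "(\<And>n. ell2_nth x n = ell2_nth y n) \<Longrightarrow> x = y"
  by (simp add: ell2_nth_inject[symmetric] fun_eq_iff)

lemma ell2_nth_Abs: "square_summable c \<Longrightarrow> ell2_nth (Abs_ell2 c) = c"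
  by (simp add: Abs_ell2_inverse)

lemma square_summable_ell2_nth: "square_summable (ell2_nth x)"
  using ell2_nth[of x] by simp

lemma square_summable_zero: "square_summable (\<lambda>_. 0)"
  by (simp add: square_summable_def)

lemma square_summable_add:
  assumes "square_summable c" "square_summable d"
  shows "square_summable (\<lambda>n. c n + d n)"
  unfolding square_summable_def
proof (rule summable_comparison_test')
  show "summable (\<lambda>n. 2 * (cmod (c n))\<^sup>2 + 2 * (cmod (d n))\<^sup>2)"
    using assms by (intro summable_add summable_mult) (auto simp: square_summable_def)
  show "norm ((cmod (c n + d n))\<^sup>2) \<le> 2 * (cmod (c n))\<^sup>2 + 2 * (cmod (d n))\<^sup>2" for n
  proof -
    have "(cmod (c n + d n))\<^sup>2 \<le> (cmod (c n) + cmod (d n))\<^sup>2"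
      by (intro power_mono norm_triangle_ineq) auto
    also have "\<dots> \<le> 2 * (cmod (c n))\<^sup>2 + 2 * (cmod (d n))\<^sup>2"
      using zero_le_power2[of "cmod (c n) - cmod (d n)"]
      by (simp add: power2_sum power2_diff)
    finally show ?thesis by simp
  qed
qed

lemma square_summable_scale:
  assumes "square_summable c"
  shows "square_summable (\<lambda>n. a * c n)"
  using assms by (simp add: square_summable_def norm_mult power_mult_distrib summable_mult)

lemma square_summable_minus:
  "square_summable c \<Longrightarrow> square_summable (\<lambda>n. - c n)"
  by (simp add: square_summable_def)

lemma square_summable_diff:
  "square_summable c \<Longrightarrow> square_summable d \<Longrightarrow> square_summable (\<lambda>n. c n - d n)"
  using square_summable_add[of c "\<lambda>n. - d n"] by (simp add: square_summable_def)

lemma square_summable_product: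
  assumes "square_summable c" "square_summable d"
  shows "summable (\<lambda>n. c n * cnj (d n))"
proof (rule summable_norm_cancel, rule summable_comparison_test')
  show "summable (\<lambda>n. (cmod (c n))\<^sup>2 + (cmod (d n))\<^sup>2)"
    using assms by (intro summable_add) (auto simp: square_summable_def)
  show "norm (norm (c n * cnj (d n))) \<le> (cmod (c n))\<^sup>2 + (cmod (d n))\<^sup>2" for n
  proof -
    have "2 * (cmod (c n) * cmod (d n)) \<le> (cmod (c n))\<^sup>2 + (cmod (d n))\<^sup>2"
      using zero_le_power2[of "cmod (c n) - cmod (d n)"] by (simp add: power2_diff)
    moreover have "0 \<le> cmod (c n) * cmod (d n)" by simp
    ultimately have "cmod (c n) * cmod (d n) \<le> (cmod (c n))\<^sup>2 + (cmod (d n))\<^sup>2" by linarith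
    then show ?thesis by (simp add: norm_mult)
  qed
qed

instantiation ell2 :: complex_inner
begin

definition zero_ell2 :: ell2 where "0 = Abs_ell2 (\<lambda>_. 0)"
definition plus_ell2 :: "ell2 \<Rightarrow> ell2 \<Rightarrow> ell2"
  where "x + y = Abs_ell2 (\<lambda>n. ell2_nth x n + ell2_nth y n)"
definition minus_ell2 :: "ell2 \<Rightarrow> ell2 \<Rightarrow> ell2"
  where "x - y = Abs_ell2 (\<lambda>n. ell2_nth x n - ell2_nth y n)"
definition uminus_ell2 :: "ell2 \<Rightarrow> ell2" where "- x = Abs_ell2 (\<lambda>n. - ell2_nth x n)"
definition scaleC_ell2 :: "complex \<Rightarrow> ell2 \<Rightarrow> ell2"
  where "a *\<^sub>C x = Abs_ell2 (\<lambda>n. a * ell2_nth x n)"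
definition scaleR_ell2 :: "real \<Rightarrow> ell2 \<Rightarrow> ell2"
  where "scaleR r x = complex_of_real r *\<^sub>C (x :: ell2)"
definition cinner_ell2 :: "ell2 \<Rightarrow> ell2 \<Rightarrow> complex"
  where "cinner x y = (\<Sum>n. ell2_nth x n * cnj (ell2_nth y n))"
definition inner_ell2 :: "ell2 \<Rightarrow> ell2 \<Rightarrow> real"
  where "inner x y = Re (cinner x (y :: ell2))"
definition norm_ell2 :: "ell2 \<Rightarrow> real" where "norm x = sqrt (inner x (x :: ell2))"
definition dist_ell2 :: "ell2 \<Rightarrow> ell2 \<Rightarrow> real" where "dist x y = norm (x - y :: ell2)"
definition sgn_ell2 :: "ell2 \<Rightarrow> ell2" where "sgn x = scaleR (inverse (norm x)) (x :: ell2)"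
definition uniformity_ell2 :: "(ell2 \<times> ell2) filter"
  where "uniformity = (INF e\<in>{0<..}. principal {(x, y :: ell2). dist x y < e})"
definition open_ell2 :: "ell2 set \<Rightarrow> bool"
  where "open_ell2 U = (\<forall>x\<in>U. \<forall>\<^sub>F (x', y) in uniformity. x' = x \<longrightarrow> y \<in> U)"

lemma nth_zero_ell2: "ell2_nth 0 n = 0"
  by (simp add: zero_ell2_def ell2_nth_Abs square_summable_zero)
lemma nth_plus_ell2: "ell2_nth (x + y) n = ell2_nth x n + ell2_nth y n"
  by (simp add: plus_ell2_def ell2_nth_Abs square_summable_add square_summable_ell2_nth)
lemma nth_minus_ell2: "ell2_nth (x - y) n = ell2_nth x n - ell2_nth y n"
  by (simp add: minus_ell2_def ell2_nth_Abs square_summable_diff square_summable_ell2_nth)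
lemma nth_uminus_ell2: "ell2_nth (- x) n = - ell2_nth x n"
  by (simp add: uminus_ell2_def ell2_nth_Abs square_summable_minus square_summable_ell2_nth)
lemma nth_scaleC_ell2: "ell2_nth (a *\<^sub>C x) n = a * ell2_nth x n"
  by (simp add: scaleC_ell2_def ell2_nth_Abs square_summable_scale square_summable_ell2_nth)

lemmas nth_ell2 = nth_zero_ell2 nth_plus_ell2 nth_minus_ell2 nth_uminus_ell2 nth_scaleC_ell2

lemma cinner_ell2_sums:
  "(\<lambda>n. ell2_nth x n * cnj (ell2_nth y n)) sums cinner x y"
  unfolding cinner_ell2_def
  by (intro summable_sums square_summable_product square_summable_ell2_nth)

lemma inner_ell2_self_sums: "(\<lambda>n. (cmod (ell2_nth x n))\<^sup>2) sums inner x x"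
proof -
  have "(\<lambda>n. Re (ell2_nth x n * cnj (ell2_nth x n))) sums Re (cinner x x)"
    by (rule sums_Re[OF cinner_ell2_sums])
  moreover have "Re (ell2_nth x n * cnj (ell2_nth x n)) = (cmod (ell2_nth x n))\<^sup>2" for n
    by (simp only: complex_norm_square[symmetric]) simp
  ultimately show ?thesis
    by (simp only: inner_ell2_def)
qed

instance
proof
  fix x y z :: ell2 and r s :: real and a b :: complex
  show "x + y + z = x + (y + z)" by (rule ell2_eqI) (simp add: nth_ell2)
  show "x + y = y + x" by (rule ell2_eqI) (simp add: nth_ell2)
  show "0 + x = x" by (rule ell2_eqI) (simp add: nth_ell2)
  show "- x + x = 0" by (rule ell2_eqI) (simp add: nth_ell2)
  show "x - y = x + - y" by (rule ell2_eqI) (simp add: nth_ell2)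
  show "scaleR r (x + y) = scaleR r x + scaleR r y"
    by (rule ell2_eqI) (simp add: nth_ell2 scaleR_ell2_def algebra_simps)
  show "scaleR (r + s) x = scaleR r x + scaleR s x"
    by (rule ell2_eqI) (simp add: nth_ell2 scaleR_ell2_def algebra_simps)
  show "scaleR r (scaleR s x) = scaleR (r * s) x"
    by (rule ell2_eqI) (simp add: nth_ell2 scaleR_ell2_def algebra_simps)
  show "scaleR 1 x = x"
    by (rule ell2_eqI) (simp add: nth_ell2 scaleR_ell2_def)
  show "sgn x = scaleR (inverse (norm x)) x" by (rule sgn_ell2_def)
  show "dist x y = norm (x - y)" by (rule dist_ell2_def)
  show "uniformity = (INF e\<in>{0<..}. principal {(x, y :: ell2). dist x y < e})"
    by (rule uniformity_ell2_def)
  show "open U = (\<forall>x\<in>U. \<forall>\<^sub>F (x', y) in uniformity. x' = x \<longrightarrow> y \<in> U)" for U :: "ell2 set"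
    by (rule open_ell2_def)
  show "norm x = sqrt (inner x x)" by (rule norm_ell2_def)
  show "inner x y = Re (cinner x y)" by (rule inner_ell2_def)
  show comm: "cinner x y = cnj (cinner y x)" for x y :: ell2
  proof (rule sums_unique2[OF cinner_ell2_sums])
    have "(\<lambda>n. cnj (ell2_nth y n * cnj (ell2_nth x n))) sums cnj (cinner y x)"
      using cinner_ell2_sums[of y x] by (simp only: sums_cnj)
    then show "(\<lambda>n. ell2_nth x n * cnj (ell2_nth y n)) sums cnj (cinner y x)"
      by (simp add: mult.commute)
  qed
  show "inner x y = inner y x"
    unfolding inner_ell2_def by (subst comm) simp
  show add: "cinner (x + y) z = cinner x z + cinner y z"
    using sums_unique2[OF cinner_ell2_sums[of "x + y" z]]
      sums_add[OF cinner_ell2_sums[of x z] cinner_ell2_sums[of y z]]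
    by (simp add: nth_ell2 algebra_simps)
  show "inner (x + y) z = inner x z + inner y z"
    by (simp add: inner_ell2_def add)
  show scale: "cinner (a *\<^sub>C x) y = a * cinner x y" for a
    using sums_unique2[OF cinner_ell2_sums[of "a *\<^sub>C x" y]]
      sums_mult[OF cinner_ell2_sums[of x y], of a]
    by (simp add: nth_ell2 mult.assoc)
  show "inner (scaleR r x) y = r * inner x y"
    by (simp add: inner_ell2_def scaleR_ell2_def scale)
  show "0 \<le> inner x x"
    by (rule sums_le[OF _ sums_zero inner_ell2_self_sums]) simp
  show "inner x x = 0 \<longleftrightarrow> x = 0"
  proof
    assume "inner x x = 0"
    then have "(\<lambda>n. (cmod (ell2_nth x n))\<^sup>2) sums 0"
      using inner_ell2_self_sums[of x] by simp
    then have "(cmod (ell2_nth x n))\<^sup>2 = 0" for n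
      using suminf_eq_zero_iff[of "\<lambda>n. (cmod (ell2_nth x n))\<^sup>2"]
      by (simp add: sums_iff)
    then show "x = 0" by (intro ell2_eqI) (simp add: nth_ell2)
  next
    assume "x = 0"
    then show "inner x x = 0"
      by (simp add: inner_ell2_def cinner_ell2_def nth_ell2)
  qed
  show "a *\<^sub>C (x + y) = a *\<^sub>C x + a *\<^sub>C y"
    by (rule ell2_eqI) (simp add: nth_ell2 algebra_simps)
  show "(a + b) *\<^sub>C x = a *\<^sub>C x + b *\<^sub>C x"
    by (rule ell2_eqI) (simp add: nth_ell2 algebra_simps)
  show "a *\<^sub>C (b *\<^sub>C x) = (a * b) *\<^sub>C x"
    by (rule ell2_eqI) (simp add: nth_ell2 algebra_simps)
  show "complex_of_real r *\<^sub>C x = scaleR r x" by (simp add: scaleR_ell2_def)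
qed

end

lemma norm_ell2_sums: "(\<lambda>n. (cmod (ell2_nth x n))\<^sup>2) sums (norm x)\<^sup>2"
  using inner_ell2_self_sums[of x] by (simp add: power2_norm_eq_inner)

lemma sum_le_norm_ell2:
  "finite I \<Longrightarrow> (\<Sum>i\<in>I. (cmod (ell2_nth x i))\<^sup>2) \<le> (norm x)\<^sup>2"
  using sum_le_suminf[of "\<lambda>n. (cmod (ell2_nth x n))\<^sup>2" I] norm_ell2_sums[of x]
  by (simp add: sums_iff)

lemma cmod_ell2_nth_le: "cmod (ell2_nth x n) \<le> norm x"
proof -
  have "(cmod (ell2_nth x n))\<^sup>2 \<le> (norm x)\<^sup>2"
    using sum_le_norm_ell2[of "{n}" x] by simp
  then show ?thesis by (rule power2_le_imp_le) simp
qed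

instance ell2 :: chilbert_space
proof
  fix X :: "nat \<Rightarrow> ell2"
  assume X: "Cauchy X"
  have "Cauchy (\<lambda>m. ell2_nth (X m) k)" for k
  proof (rule metric_CauchyI)
    fix e :: real assume "e > 0"
    then obtain M where M: "\<And>m n. m \<ge> M \<Longrightarrow> n \<ge> M \<Longrightarrow> dist (X m) (X n) < e"
      using metric_CauchyD[OF X] by blast
    have "dist (ell2_nth (X m) k) (ell2_nth (X n) k) < e" if "m \<ge> M" "n \<ge> M" for m n
      using cmod_ell2_nth_le[of "X m - X n" k] M[OF that] by (simp add: dist_norm nth_ell2)
    then show "\<exists>M. \<forall>m\<ge>M. \<forall>n\<ge>M. dist (ell2_nth (X m) k) (ell2_nth (X n) k) < e" by blast
  qed
  then have "\<exists>l. (\<lambda>m. ell2_nth (X m) k) \<longlonglongrightarrow> l" for k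
    using Cauchy_convergent convergent_def by blast
  then obtain l where l: "\<And>k. (\<lambda>m. ell2_nth (X m) k) \<longlonglongrightarrow> l k" by metis
  have key: "\<exists>M. \<forall>m\<ge>M. \<forall>K. (\<Sum>k<K. (cmod (ell2_nth (X m) k - l k))\<^sup>2) \<le> e\<^sup>2"
    if e: "e > 0" for e :: real
  proof -
    obtain M where M: "\<And>m n. m \<ge> M \<Longrightarrow> n \<ge> M \<Longrightarrow> dist (X m) (X n) < e"
      using metric_CauchyD[OF X e] by blast
    have "(\<Sum>k<K. (cmod (ell2_nth (X m) k - l k))\<^sup>2) \<le> e\<^sup>2" if m: "m \<ge> M" for m K
    proof (rule tendsto_upperbound)
      show "(\<lambda>n. \<Sum>k<K. (cmod (ell2_nth (X m) k - ell2_nth (X n) k))\<^sup>2)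
              \<longlonglongrightarrow> (\<Sum>k<K. (cmod (ell2_nth (X m) k - l k))\<^sup>2)"
        by (intro tendsto_intros l)
      have "(\<Sum>k<K. (cmod (ell2_nth (X m) k - ell2_nth (X n) k))\<^sup>2) \<le> e\<^sup>2" if n: "n \<ge> M" for n
      proof -
        have "(\<Sum>k<K. (cmod (ell2_nth (X m - X n) k))\<^sup>2) \<le> (norm (X m - X n))\<^sup>2"
          by (rule sum_le_norm_ell2) simp
        also have "\<dots> \<le> e\<^sup>2"
          using M[OF m n] by (intro power_mono) (auto simp: dist_norm)
        finally show ?thesis by (simp add: nth_ell2)
      qed
      then show "\<forall>\<^sub>F n in sequentially.
          (\<Sum>k<K. (cmod (ell2_nth (X m) k - ell2_nth (X n) k))\<^sup>2) \<le> e\<^sup>2"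
        using eventually_sequentially by blast
    qed simp
    then show ?thesis by blast
  qed
  have diff: "square_summable (\<lambda>k. ell2_nth (X m) k - l k)"
    if "\<And>K. (\<Sum>k<K. (cmod (ell2_nth (X m) k - l k))\<^sup>2) \<le> e" for m e
    unfolding square_summable_def by (rule summableI_nonneg_bounded[OF _ that]) simp
  obtain m where "\<forall>K. (\<Sum>k<K. (cmod (ell2_nth (X m) k - l k))\<^sup>2) \<le> 1\<^sup>2"
    using key[of 1] by auto
  then have "square_summable (\<lambda>k. ell2_nth (X m) k - (ell2_nth (X m) k - l k))"
    by (intro square_summable_diff square_summable_ell2_nth diff) auto
  then have nth_L: "ell2_nth (Abs_ell2 l) k = l k" for k
    by (simp add: ell2_nth_Abs)
  have "X \<longlonglongrightarrow> Abs_ell2 l"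
  proof (rule metric_LIMSEQ_I)
    fix r :: real assume r: "r > 0"
    obtain M where M: "\<And>m K. m \<ge> M \<Longrightarrow>
        (\<Sum>k<K. (cmod (ell2_nth (X m) k - l k))\<^sup>2) \<le> (r/2)\<^sup>2"
      using key[of "r/2"] r by auto
    have "dist (X m) (Abs_ell2 l) < r" if m: "m \<ge> M" for m
    proof -
      have "(norm (X m - Abs_ell2 l))\<^sup>2 \<le> (r/2)\<^sup>2"
        using norm_ell2_sums[of "X m - Abs_ell2 l"] M[OF m]
        by (intro LIMSEQ_le_const2[of _ "(norm (X m - Abs_ell2 l))\<^sup>2"])
           (auto simp: sums_def nth_ell2 nth_L)
      then have "norm (X m - Abs_ell2 l) \<le> r/2"
        by (rule power2_le_imp_le) (use r in simp)
      then show ?thesis using r by (simp add: dist_norm)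
    qed
    then show "\<exists>M. \<forall>m\<ge>M. dist (X m) (Abs_ell2 l) < r" by blast
  qed
  then show "convergent X" by (auto simp: convergent_def)
qed


section \<open>Bounded operators\<close>

definition bounded_clinear :: "('a::complex_inner \<Rightarrow> 'b::complex_inner) \<Rightarrow> bool"
  where "bounded_clinear T \<longleftrightarrow> bounded_linear T \<and> (\<forall>c x. T (c *\<^sub>C x) = c *\<^sub>C T x)"

definition positive_op :: "('a::complex_inner \<Rightarrow> 'a) \<Rightarrow> bool"
  where "positive_op T \<longleftrightarrow> bounded_clinear T \<and> (\<forall>x. cinner (T x) x \<in> \<real>\<^sub>\<ge>\<^sub>0)"

text \<open>
  A bounded operator between Hilbert spaces has exactly one adjoint, and a positive operator on a
  Hilbert space has exactly one positive square root; the following two functions are only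
  meaningful in these cases.
\<close>

definition cadjoint :: "('a::complex_inner \<Rightarrow> 'b::complex_inner) \<Rightarrow> 'b \<Rightarrow> 'a"
  where "cadjoint T = (THE S. \<forall>x y. cinner (T x) y = cinner x (S y))"

definition op_sqrt :: "('a::complex_inner \<Rightarrow> 'a) \<Rightarrow> 'a \<Rightarrow> 'a"
  where "op_sqrt T = (THE S. positive_op S \<and> S \<circ> S = T)"

definition op_inner :: "('a::complex_inner \<Rightarrow> 'a) \<Rightarrow> 'a \<Rightarrow> 'a \<Rightarrow> complex"
  where "op_inner T f g = cinner (T f) g"

text \<open>For positive \<open>T\<close> the number \<open>op_inner T f f\<close> is real and nonnegative.\<close>

definition op_norm :: "('a::complex_inner \<Rightarrow> 'a) \<Rightarrow> 'a \<Rightarrow> real"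
  where "op_norm T f = sqrt (Re (op_inner T f f))"


section \<open>Frames\<close>

definition analysis_dom :: "('a::complex_inner \<Rightarrow> 'a) \<Rightarrow> (nat \<Rightarrow> 'a) \<Rightarrow> 'a set"
  where "analysis_dom A F = {f. square_summable (\<lambda>n. op_inner A f (F n))}"

text \<open>The value is meaningful only for \<open>f \<in> analysis_dom A F\<close>.\<close>

definition analysis_op :: "('a::complex_inner \<Rightarrow> 'a) \<Rightarrow> (nat \<Rightarrow> 'a) \<Rightarrow> 'a \<Rightarrow> ell2"
  where "analysis_op A F f = Abs_ell2 (\<lambda>n. op_inner A f (F n))"

definition AB_frame :: "('a::complex_inner \<Rightarrow> 'a) \<Rightarrow> (ell2 \<Rightarrow> ell2) \<Rightarrow> (nat \<Rightarrow> 'a) \<Rightarrow> bool"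
  where "AB_frame A B F \<longleftrightarrow>
    analysis_dom A F = UNIV \<and>
    (\<exists>\<alpha>>0. \<exists>\<beta>>0. \<forall>f.
      \<alpha> * (op_norm A f)\<^sup>2 \<le> (op_norm B (analysis_op A F f))\<^sup>2 \<and>
      (op_norm B (analysis_op A F f))\<^sup>2 \<le> \<beta> * (op_norm A f)\<^sup>2)"

end

theory Submission
  imports Defs
begin

text \<open>
  Put \<open>S = A\<^sup>1\<^sup>/\<^sup>2\<close> and \<open>T = B\<^sup>1\<^sup>/\<^sup>2 C\<close>.  Since \<open>\<parallel>f\<parallel>\<^sub>A = \<parallel>S f\<parallel>\<close> and \<open>\<parallel>C f\<parallel>\<^sub>B = \<parallel>T f\<parallel>\<close>, the frame
  inequalities say that each of \<open>T\<close> and \<open>S\<close> dominates the other in norm up to a constant, and by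
  Douglas' lemma this means that the adjoints have the same range.

  One direction of Douglas' lemma is a Riesz representation: the functional \<open>\<langle>T f, y\<rangle>\<close> is dominated by
  \<open>\<parallel>S f\<parallel>\<close>, hence is of the form \<open>\<langle>S f, z\<rangle>\<close>.  For the other one, inclusion of the ranges makes the image
  under \<open>T\<close> of \<open>{f. \<parallel>S f\<parallel> \<le> 1}\<close> weakly bounded, hence bounded.
\<close>

section \<open>Riesz representation and weak boundedness\<close>

text \<open>
  The vector \<open>z\<close> is the limit of \<open>S x\<close> along a minimising sequence of \<open>\<parallel>S x\<parallel>\<^sup>2 - 2 \<phi> x\<close>; it need not
  lie in the range of \<open>S\<close>.
\<close>
lemma riesz_along:
  fixes S :: "'a::real_vector \<Rightarrow> 'b::{real_inner, complete_space}" and \<phi> :: "'a \<Rightarrow> real"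
  assumes S: "linear S" and \<phi>: "linear \<phi>" and le: "\<And>x. \<phi> x \<le> c * norm (S x)"
  shows "\<exists>z. \<forall>x. \<phi> x = inner (S x) z"
proof -
  define J where "J x = (norm (S x))\<^sup>2 - 2 * \<phi> x" for x
  define m where "m = Inf (range J)"
  \<comment> \<open>With \<open>t = norm (S x)\<close> the bound on \<open>\<phi>\<close> gives
    \<open>J x \<ge> t\<^sup>2 - 2 * c * t\<close>, and completing the square bounds this below by
    \<open>- c\<^sup>2\<close>.\<close>
  have "- c\<^sup>2 \<le> J x" for x
    using le[of x] zero_le_power2[of "norm (S x) - c"]
    unfolding J_def power2_diff by (simp add: mult.commute)
  then have m: "m \<le> J x" for x
    unfolding m_def by (intro cInf_lower) (auto intro!: bdd_belowI2)
  have "\<exists>x. J x < m + inverse (Suc n)" for n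
    using cInf_lessD[of "range J" "m + inverse (Suc n)"] by (auto simp: m_def)
  then obtain f where f: "\<And>n. J (f n) < m + inverse (Suc n)"
    by metis
  have dist: "(dist (S (f i)) (S (f k)))\<^sup>2 \<le> 2 * inverse (Suc i) + 2 * inverse (Suc k)" for i k
  proof -
    \<comment> \<open>Parallelogram law: the terms in \<open>\<phi>\<close> cancel by linearity, and
      the value of \<open>J\<close> at the midpoint is at least \<open>m\<close>.\<close>
    have "(dist (S (f i)) (S (f k)))\<^sup>2 =
        2 * J (f i) + 2 * J (f k) - 4 * J ((1/2) *\<^sub>R (f i + f k))"
      by (simp add: J_def dist_norm power2_norm_eq_inner linear_add[OF S] linear_add[OF \<phi>]
          linear_scale[OF S] linear_scale[OF \<phi>] inner_commute algebra_simps)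
    then show ?thesis
      using f[of i] f[of k] m[of "(1/2) *\<^sub>R (f i + f k)"] by linarith
  qed
  have "Cauchy (\<lambda>n. S (f n))"
  proof (rule metric_CauchyI)
    fix e :: real assume e: "e > 0"
    then obtain N where N: "inverse (real (Suc N)) < e\<^sup>2 / 4"
      using reals_Archimedean[of "e\<^sup>2 / 4"] by auto
    have "dist (S (f i)) (S (f k)) < e" if "i \<ge> N" "k \<ge> N" for i k
    proof (rule power2_less_imp_less)
      have "inverse (real (Suc i)) \<le> inverse (real (Suc N))"
        "inverse (real (Suc k)) \<le> inverse (real (Suc N))"
        using that by (intro le_imp_inverse_le; simp)+
      then show "(dist (S (f i)) (S (f k)))\<^sup>2 < e\<^sup>2"
        using dist[of i k] N by linarith
    qed (use e in simp)
    then show "\<exists>M. \<forall>i\<ge>M. \<forall>k\<ge>M. dist (S (f i)) (S (f k)) < e"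
      by blast
  qed
  then obtain z where z: "(\<lambda>n. S (f n)) \<longlonglongrightarrow> z"
    using Cauchy_convergent convergent_def by blast
  \<comment> \<open>The right-hand side is the limit of the increments of \<open>J\<close> from
    \<open>f n\<close> to \<open>f n + t *\<^sub>R x\<close>, each of which exceeds
    \<open>- inverse (Suc n)\<close>.\<close>
  have var: "0 \<le> 2 * t * (inner (S x) z - \<phi> x) + t\<^sup>2 * (norm (S x))\<^sup>2" for t x
  proof (rule LIMSEQ_le_const)
    have "(\<lambda>n. 2 * t * (inner (S x) (S (f n)) - \<phi> x) + t\<^sup>2 * (norm (S x))\<^sup>2)
        \<longlonglongrightarrow> 2 * t * (inner (S x) z - \<phi> x) + t\<^sup>2 * (norm (S x))\<^sup>2"
      by (intro tendsto_intros z)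
    from tendsto_add[OF LIMSEQ_inverse_real_of_nat this]
    show "(\<lambda>n. inverse (real (Suc n)) + (2 * t * (inner (S x) (S (f n)) - \<phi> x) + t\<^sup>2 * (norm (S x))\<^sup>2))
        \<longlonglongrightarrow> 2 * t * (inner (S x) z - \<phi> x) + t\<^sup>2 * (norm (S x))\<^sup>2"
      by (simp only: add_0)
    have "0 \<le> inverse (real (Suc n)) + (2 * t * (inner (S x) (S (f n)) - \<phi> x) + t\<^sup>2 * (norm (S x))\<^sup>2)"
      for n
    proof -
      have "J (f n + t *\<^sub>R x) =
          J (f n) + (2 * t * (inner (S x) (S (f n)) - \<phi> x) + t\<^sup>2 * (norm (S x))\<^sup>2)"
        by (simp add: J_def power2_norm_eq_inner linear_add[OF S] linear_add[OF \<phi>]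
            linear_scale[OF S] linear_scale[OF \<phi>] inner_commute algebra_simps power2_eq_square[of t])
      then show ?thesis
        using f[of n] m[of "f n + t *\<^sub>R x"] by linarith
    qed
    then show "\<exists>N. \<forall>n\<ge>N. 0 \<le> inverse (real (Suc n)) +
        (2 * t * (inner (S x) (S (f n)) - \<phi> x) + t\<^sup>2 * (norm (S x))\<^sup>2)"
      by blast
  qed
  have "\<phi> x = inner (S x) z" for x
  proof (rule ccontr)
    define d where "d = inner (S x) z - \<phi> x"
    \<comment> \<open>The best step would be \<open>t = - d / (norm (S x))\<^sup>2\<close>; adding 1
      to the denominator keeps it positive when \<open>S x = 0\<close> and still makes the quadratic
      negative.\<close>
    define q where "q = (norm (S x))\<^sup>2 + 1"
    assume "\<phi> x \<noteq> inner (S x) z"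
    then have "d\<^sup>2 > 0" by (simp add: d_def)
    have "q \<ge> 1" by (simp add: q_def)
    have "0 \<le> 2 * (- d / q) * d + (- d / q)\<^sup>2 * (q - 1)"
      using var[of "- d / q" x] by (simp add: d_def q_def)
    also have "\<dots> = - (d\<^sup>2 / q) - d\<^sup>2 / q\<^sup>2"
      using \<open>q \<ge> 1\<close> by (simp add: field_simps power2_eq_square)
    also have "\<dots> < 0"
      using \<open>d\<^sup>2 > 0\<close> \<open>q \<ge> 1\<close> by (smt (verit) divide_pos_pos zero_less_power)
    finally show False by simp
  qed
  then show ?thesis by blast
qed

text \<open>Uniform boundedness by Baire: the closed sets \<open>E n\<close> cover the space, so one
  of them contains a ball. Moving from its centre by its radius \<open>r\<close> in the direction of
  \<open>x\<close> changes the inner product with \<open>x\<close> by \<open>r * norm x\<close>,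
  which is therefore at most \<open>2 * n\<close>.\<close>

lemma weakly_bounded_imp_bounded:
  fixes X :: "'a::{real_inner, complete_space} set"
  assumes "\<And>y. \<exists>M. \<forall>x\<in>X. \<bar>inner x y\<bar> \<le> M"
  shows "bounded X"
proof -
  define E where "E n = {y. \<forall>x\<in>X. \<bar>inner x y\<bar> \<le> real n}" for n
  have "closed (E n)" for n
  proof -
    have "E n = (\<Inter>x\<in>X. {y. \<bar>inner x y\<bar> \<le> real n})"
      by (auto simp: E_def)
    then show ?thesis
      by (auto intro!: closed_INT closed_Collect_le continuous_intros)
  qed
  moreover have "\<Union> (range E) = UNIV"
  proof (intro set_eqI iffI UNIV_I)
    fix y
    obtain M where M: "\<forall>x\<in>X. \<bar>inner x y\<bar> \<le> M"
      using assms by blast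
    obtain n where "M \<le> real n"
      using real_arch_simple by blast
    with M have "y \<in> E n"
      by (force simp: E_def)
    then show "y \<in> \<Union> (range E)" by blast
  qed
  ultimately obtain n where "interior (E n) \<noteq> {}"
    using Baire_category_alt[of "euclidean :: 'a topology" "range E"]
    by (force simp: completely_metrizable_space_euclidean closed_closedin[symmetric])
  then obtain y r where r: "r > 0" and ball: "cball y r \<subseteq> E n"
    by (meson equals0I mem_interior_cball)
  have "norm x \<le> 2 * real n / r" if x: "x \<in> X" for x
  proof (cases "x = 0")
    case False
    define w where "w = (r / norm x) *\<^sub>R x"
    have "y + w \<in> cball y r" "y \<in> cball y r"
      using r False by (auto simp: w_def dist_norm)
    then have "\<bar>inner x (y + w)\<bar> \<le> real n" "\<bar>inner x y\<bar> \<le> real n"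
      using ball x unfolding E_def by blast+
    then have "inner x w \<le> 2 * real n"
      by (simp add: inner_add_right)
    moreover have "inner x w = r * norm x"
      using False by (simp add: w_def power2_norm_eq_inner[symmetric] power2_eq_square)
    ultimately show ?thesis
      using r by (simp add: field_simps)
  qed (use r in simp)
  then show ?thesis
    by (auto simp: bounded_iff)
qed



section \<open>Square roots\<close>

text \<open>For a real inner product nonnegativity does not force symmetry, so symmetry is a
  separate clause. Square roots are built at this real level; complex linearity is recovered
  afterwards.\<close>

definition nonneg_selfadjoint :: "('a::real_inner \<Rightarrow> 'a) \<Rightarrow> bool"
  where "nonneg_selfadjoint A \<longleftrightarrow>
    bounded_linear A \<and> (\<forall>x y. inner (A x) y = inner x (A y)) \<and> (\<forall>x. 0 \<le> inner (A x) x)"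

lemma nonneg_selfadjointD:
  assumes "nonneg_selfadjoint A"
  shows "bounded_linear A" "linear A" "inner (A x) y = inner x (A y)" "0 \<le> inner (A x) x"
  using assms by (auto simp: nonneg_selfadjoint_def bounded_linear.linear)

text \<open>This is the operator inequality \<open>A\<^sup>2 \<le> c A\<close>. It comes from
  testing nonnegativity of \<open>A\<close> on the vector \<open>c x - A x\<close>.\<close>

lemma nonneg_selfadjoint_norm_sq_le:
  assumes A: "nonneg_selfadjoint A" and c: "c > 0" "\<And>x. norm (A x) \<le> c * norm x"
  shows "(norm (A x))\<^sup>2 \<le> c * inner (A x) x"
proof -
  note A = nonneg_selfadjointD[OF A]
  define v where "v = c *\<^sub>R x - A x"
  have "inner (A v) v = c\<^sup>2 * inner (A x) x - 2 * c * (norm (A x))\<^sup>2 + inner (A (A x)) (A x)"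
    by (simp add: v_def linear_diff[OF A(2)] linear_scale[OF A(2)] power2_norm_eq_inner
        A(3)[of "A x" x] algebra_simps power2_eq_square[of c])
  moreover have "inner (A (A x)) (A x) \<le> c * (norm (A x))\<^sup>2"
    using norm_cauchy_schwarz[of "A (A x)" "A x"] mult_right_mono[OF c(2)[of "A x"] norm_ge_zero[of "A x"]]
    by (simp add: power2_eq_square mult.assoc)
  ultimately have "c * (norm (A x))\<^sup>2 \<le> c * (c * inner (A x) x)"
    using A(4)[of v] by (simp add: power2_eq_square)
  then show ?thesis
    using c(1) by simp
qed

text \<open>
  With \<open>X = 1 - A\<close> the root is \<open>1 - Z\<close>, where \<open>Z = (X + Z\<^sup>2) / 2\<close> is found by fixed-point iteration from
  \<open>0\<close>.  The iterates \<open>Y n\<close> are polynomials in \<open>X\<close> with nonnegative coefficients, so they and their increments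
  are bounded in norm by those of the scalar iteration \<open>y n\<close> for \<open>X = 1\<close>.  The commutation property gives
  uniqueness of the root as well as its complex linearity.
\<close>
lemma sqrt_contraction_exists:
  fixes A :: "'a::{real_inner, complete_space} \<Rightarrow> 'a"
  assumes A: "nonneg_selfadjoint A" and A_le: "\<And>x. norm (A x) \<le> norm x"
  shows "\<exists>S. nonneg_selfadjoint S \<and> S \<circ> S = A \<and>
    (\<forall>R. bounded_linear R \<and> R \<circ> A = A \<circ> R \<longrightarrow> R \<circ> S = S \<circ> R)"
proof -
  note AD = nonneg_selfadjointD[OF A]
  define X where "X x = x - A x" for x
  define Y where "Y n = ((\<lambda>Z x. (1/2) *\<^sub>R (X x + Z (Z x))) ^^ n) (\<lambda>_. 0)" for n
  define y :: "nat \<Rightarrow> real" where "y n = ((\<lambda>t. (1 + t\<^sup>2) / 2) ^^ n) 0" for n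
  have Y_0: "Y 0 x = 0" and Y_Suc: "Y (Suc n) x = (1/2) *\<^sub>R (X x + Y n (Y n x))" for n x
    by (simp_all add: Y_def)
  have y_0: "y 0 = 0" and y_Suc: "y (Suc n) = (1 + (y n)\<^sup>2) / 2" for n
    by (simp_all add: y_def)
  have X_lin: "linear X"
    unfolding X_def using AD(2) by (simp add: linear_iff algebra_simps)
  have X_sym: "inner (X u) v = inner u (X v)" for u v
    by (simp add: X_def inner_diff AD(3))
  have X_le: "norm (X x) \<le> norm x" for x
  proof (rule power2_le_imp_le)
    \<comment> \<open>By the preceding inequality with \<open>c = 1\<close>, the last two terms add
      up to at most \<open>- inner (A x) x\<close>.\<close>
    have "(norm (X x))\<^sup>2 = (norm x)\<^sup>2 - 2 * inner (A x) x + (norm (A x))\<^sup>2"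
      by (simp add: X_def power2_norm_eq_inner inner_diff inner_commute)
    then show "(norm (X x))\<^sup>2 \<le> (norm x)\<^sup>2"
      using nonneg_selfadjoint_norm_sq_le[OF A, of 1 x] A_le AD(4)[of x] by simp
  qed simp
  have Y_lin: "linear (Y n)" for n
  proof (induction n)
    case 0
    then show ?case by (simp add: linear_iff Y_0)
  next
    case (Suc n)
    then show ?case
      by (simp add: linear_iff Y_Suc linear_add[OF X_lin] linear_scale[OF X_lin] algebra_simps)
  qed
  have Y_sym: "inner (Y n u) v = inner u (Y n v)" for n u v
    by (induction n arbitrary: u v) (simp_all add: Y_0 Y_Suc X_sym inner_add)
  \<comment> \<open>A polynomial in \<open>X\<close> commutes with every linear map that commutes
    with \<open>X\<close>. This serves both for the iterates among themselves and, in the limit, for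
    the commutation property of the root.\<close>
  have Y_comm: "R (Y n x) = Y n (R x)" if R: "linear R" "\<And>x. R (X x) = X (R x)" for R n x
    by (induction n arbitrary: x)
      (simp_all add: Y_0 Y_Suc linear_0[OF R(1)] linear_scale[OF R(1)] linear_add[OF R(1)] R(2))
  have XY: "Y n (X x) = X (Y n x)" for n x
    using Y_comm[of X, OF X_lin] by simp
  have YY: "Y n (Y k x) = Y k (Y n x)" for n k x
    by (intro Y_comm Y_lin XY)
  have y_bd: "0 \<le> y n" "y n \<le> 1" for n
  proof (induction n)
    case (Suc n)
    { case 1 then show ?case by (simp add: y_Suc) }
    { case 2 then show ?case using Suc power_le_one[of "y n" 2] by (simp add: y_Suc) }
  qed (simp_all add: y_0)
  have y_inc: "y n \<le> y (Suc n)" for n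
    using zero_le_power2[of "1 - y n"] by (simp add: y_Suc power2_diff)
  have Y_le: "norm (Y n x) \<le> y n * norm x" for n x
  proof (induction n arbitrary: x)
    case (Suc n)
    have "norm (Y n (Y n x)) \<le> y n * norm (Y n x)"
      by (rule Suc)
    also have "\<dots> \<le> y n * (y n * norm x)"
      by (intro mult_left_mono Suc y_bd)
    finally have "norm (X x + Y n (Y n x)) \<le> norm x + (y n)\<^sup>2 * norm x"
      using norm_triangle_ineq[of "X x" "Y n (Y n x)"] X_le[of x]
      by (simp add: power2_eq_square mult.assoc)
    moreover have "norm (Y (Suc n) x) = norm (X x + Y n (Y n x)) / 2"
      by (simp only: Y_Suc norm_scaleR)
    ultimately show ?case
      by (simp add: y_Suc field_simps)
  qed (simp add: Y_0 y_0)
  have Y_step: "norm (Y (Suc n) x - Y n x) \<le> (y (Suc n) - y n) * norm x" for n x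
  proof (induction n arbitrary: x)
    case 0
    then show ?case
      using X_le[of x] by (simp add: Y_0 Y_Suc y_0 y_Suc)
  next
    case (Suc n)
    define u where "u = Y (Suc n) x + Y n x"
    have "Y (Suc (Suc n)) x - Y (Suc n) x =
        (1/2) *\<^sub>R (Y (Suc n) (Y (Suc n) x) - Y n (Y n x))"
      unfolding Y_Suc[of "Suc n"] by (subst (3) Y_Suc) (simp add: algebra_simps)
    \<comment> \<open>Difference of squares, valid because consecutive iterates commute; the
      induction hypothesis then applies at \<open>u\<close>.\<close>
    also have "\<dots> = (1/2) *\<^sub>R (Y (Suc n) u - Y n u)"
      by (simp add: u_def linear_add[OF Y_lin] YY[of n "Suc n"])
    finally have "norm (Y (Suc (Suc n)) x - Y (Suc n) x) = (1/2) * norm (Y (Suc n) u - Y n u)"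
      by simp
    also have "\<dots> \<le> (1/2) * ((y (Suc n) - y n) * norm u)"
      using Suc[of u] by simp
    also have "\<dots> \<le> (1/2) * ((y (Suc n) - y n) * (y (Suc n) * norm x + y n * norm x))"
      unfolding u_def using y_inc[of n] Y_le[of n x] Y_le[of "Suc n" x]
      by (intro mult_left_mono norm_triangle_le add_mono) auto
    also have "\<dots> = ((y (Suc n))\<^sup>2 - (y n)\<^sup>2) / 2 * norm x"
      by (simp add: power2_eq_square field_simps)
    also have "((y (Suc n))\<^sup>2 - (y n)\<^sup>2) / 2 = y (Suc (Suc n)) - y (Suc n)"
      using y_Suc[of n] y_Suc[of "Suc n"] by (simp add: field_simps)
    finally show ?case .
  qed
  have Y_diff: "norm (Y k x - Y n x) \<le> (y k - y n) * norm x" if "n \<le> k" for n k x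
    using that
  proof (induction rule: dec_induct)
    case (step k)
    then show ?case
      using norm_triangle_ineq[of "Y (Suc k) x - Y k x" "Y k x - Y n x"] Y_step[of k x]
      by (simp add: algebra_simps)
  qed simp
  have "convergent y"
  proof (rule Bseq_mono_convergent)
    show "Bseq y"
      using y_bd by (intro BseqI'[of _ 1]) simp
    show "\<forall>m. \<forall>n\<ge>m. y m \<le> y n"
      by (blast intro: lift_Suc_mono_le[of y, OF y_inc])
  qed
  then have "Cauchy y"
    by (simp add: Cauchy_convergent_iff)
  have "Cauchy (\<lambda>n. Y n x)" for x
  proof (rule metric_CauchyI)
    fix e :: real assume "e > 0"
    \<comment> \<open>The \<open>+ 1\<close> keeps the denominator positive at
      \<open>x = 0\<close>.\<close>
    then have "e / (norm x + 1) > 0"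
      by (simp add: add_nonneg_pos)
    then obtain N where N: "\<And>k n. k \<ge> N \<Longrightarrow> n \<ge> N \<Longrightarrow> dist (y k) (y n) < e / (norm x + 1)"
      using metric_CauchyD[OF \<open>Cauchy y\<close>] by blast
    have less: "dist (Y k x) (Y n x) < e" if "k \<ge> n" "n \<ge> N" for k n
    proof -
      have "dist (Y k x) (Y n x) \<le> dist (y k) (y n) * (norm x + 1)"
        using Y_diff[OF \<open>k \<ge> n\<close>, of x] by (simp add: dist_norm) (smt (verit) mult_mono norm_ge_zero)
      also have "\<dots> < e"
        using N[of k n] that by (simp add: pos_less_divide_eq add_nonneg_pos)
      finally show ?thesis .
    qed
    have "dist (Y k x) (Y n x) < e" if "k \<ge> N" "n \<ge> N" for k n
      using less[of n k] less[of k n] that by (cases "k \<le> n") (auto simp: dist_commute)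
    then show "\<exists>M. \<forall>m\<ge>M. \<forall>n\<ge>M. dist (Y m x) (Y n x) < e"
      by blast
  qed
  then have "\<exists>z. (\<lambda>n. Y n x) \<longlonglongrightarrow> z" for x
    using Cauchy_convergent convergent_def by blast
  then obtain Z where Z: "\<And>x. (\<lambda>n. Y n x) \<longlonglongrightarrow> Z x"
    by metis
  have Z_le: "norm (Z x) \<le> norm x" for x
  proof (rule tendsto_upperbound)
    show "(\<lambda>n. norm (Y n x)) \<longlonglongrightarrow> norm (Z x)"
      by (intro tendsto_intros Z)
    have "norm (Y n x) \<le> norm x" for n
      using Y_le[of n x] mult_right_mono[OF y_bd(2)[of n], of "norm x"] by simp
    then show "\<forall>\<^sub>F n in sequentially. norm (Y n x) \<le> norm x"
      by simp
  qed simp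
  have Z_add: "Z (u + v) = Z u + Z v" for u v
    using tendsto_add[OF Z Z, of u v] by (intro LIMSEQ_unique[OF Z]) (simp add: linear_add[OF Y_lin])
  have Z_scale: "Z (r *\<^sub>R u) = r *\<^sub>R Z u" for r u
    using tendsto_scaleR[OF tendsto_const Z, of r u]
    by (intro LIMSEQ_unique[OF Z]) (simp add: linear_scale[OF Y_lin])
  have Z_lin: "bounded_linear Z"
    by (rule bounded_linear_intro[of _ 1]) (simp_all add: Z_add Z_scale Z_le)
  have Z_sym: "inner (Z u) v = inner u (Z v)" for u v
  proof (rule LIMSEQ_unique)
    show "(\<lambda>n. inner (Y n u) v) \<longlonglongrightarrow> inner (Z u) v"
      by (intro tendsto_intros Z)
    show "(\<lambda>n. inner (Y n u) v) \<longlonglongrightarrow> inner u (Z v)"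
      unfolding Y_sym by (intro tendsto_intros Z)
  qed
  have Z_eq: "Z x = (1/2) *\<^sub>R (X x + Z (Z x))" for x
  proof (rule LIMSEQ_unique)
    show "(\<lambda>n. Y (Suc n) x) \<longlonglongrightarrow> Z x"
      by (rule LIMSEQ_Suc[OF Z])
    have lim0: "(\<lambda>n. norm (Y n x - Z x)) \<longlonglongrightarrow> 0"
      using Z[of x] by (simp add: LIM_zero_iff tendsto_norm_zero_iff)
    \<comment> \<open>Pointwise convergence alone does not give the limit of
      \<open>Y n (Y n x)\<close>. It is split as \<open>Y n (Y n x - Z x) + Y n (Z x)\<close>, where
      the first term vanishes because every \<open>Y n\<close> is a contraction.\<close>
    have "(\<lambda>n. Y n (Y n x - Z x)) \<longlonglongrightarrow> 0"
    proof (rule Lim_null_comparison[OF _ lim0], intro always_eventually allI)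
      fix n show "norm (Y n (Y n x - Z x)) \<le> norm (Y n x - Z x)"
        using Y_le[of n "Y n x - Z x"] mult_right_mono[OF y_bd(2)[of n], of "norm (Y n x - Z x)"]
        by simp
    qed
    from tendsto_add[OF this Z[of "Z x"]]
    have "(\<lambda>n. Y n (Y n x)) \<longlonglongrightarrow> Z (Z x)"
      by (simp add: linear_diff[OF Y_lin])
    then show "(\<lambda>n. Y (Suc n) x) \<longlonglongrightarrow> (1/2) *\<^sub>R (X x + Z (Z x))"
      unfolding Y_Suc by (intro tendsto_intros)
  qed
  define S where "S x = x - Z x" for x
  have "S (S x) = A x" for x
  proof -
    \<comment> \<open>For \<open>S = 1 - Z\<close> the fixed-point equation becomes
      \<open>S\<^sup>2 = 1 - 2 Z + Z\<^sup>2 = 1 - X = A\<close>.\<close>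
    have "2 *\<^sub>R Z x = X x + Z (Z x)"
      by (subst Z_eq) simp
    then have "Z x + Z x = x - A x + Z (Z x)"
      by (simp add: X_def scaleR_2)
    then show ?thesis
      by (simp add: S_def linear_diff[OF bounded_linear.linear[OF Z_lin]] algebra_simps)
  qed
  moreover have "nonneg_selfadjoint S"
    unfolding nonneg_selfadjoint_def
  proof (intro conjI allI)
    show "bounded_linear S"
      unfolding S_def by (intro bounded_linear_sub bounded_linear_ident Z_lin)
    show "inner (S u) v = inner u (S v)" for u v
      by (simp add: S_def inner_diff Z_sym)
    show "0 \<le> inner (S x) x" for x
      using norm_cauchy_schwarz[of "Z x" x] mult_right_mono[OF Z_le[of x], of "norm x"]
      by (simp add: S_def inner_diff power2_norm_eq_inner[symmetric] power2_eq_square)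
  qed
  moreover have "R (S x) = S (R x)" if R: "bounded_linear R" "R \<circ> A = A \<circ> R" for R x
  proof -
    have RA: "R (A u) = A (R u)" for u
      using R(2) by (metis comp_apply)
    have RY: "R (Y n u) = Y n (R u)" for n u
      by (intro Y_comm bounded_linear.linear R) (simp add: X_def linear_diff[OF bounded_linear.linear[OF R(1)]] RA)
    have "R (Z x) = Z (R x)"
    proof (rule LIMSEQ_unique)
      show "(\<lambda>n. Y n (R x)) \<longlonglongrightarrow> R (Z x)"
        using bounded_linear.tendsto[OF R(1) Z[of x]] by (simp add: RY)
    qed (rule Z)
    then show ?thesis
      by (simp add: S_def linear_diff[OF bounded_linear.linear[OF R(1)]])
  qed
  ultimately show ?thesis
    by (intro exI[of _ S]) (auto simp: fun_eq_iff)
qed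

text \<open>Rescaling by a norm bound \<open>c\<close> reduces to a contraction. Its root is
  multiplied by \<open>sqrt c\<close>, and commuting with \<open>A\<close> passes to the rescaled
  operator.\<close>

lemma nonneg_selfadjoint_sqrt_exists:
  fixes A :: "'a::{real_inner, complete_space} \<Rightarrow> 'a"
  assumes A: "nonneg_selfadjoint A"
  shows "\<exists>S. nonneg_selfadjoint S \<and> S \<circ> S = A \<and>
    (\<forall>R. bounded_linear R \<and> R \<circ> A = A \<circ> R \<longrightarrow> R \<circ> S = S \<circ> R)"
proof -
  note AD = nonneg_selfadjointD[OF A]
  obtain c where c: "c > 0" "\<And>x. norm (A x) \<le> norm x * c"
    using bounded_linear.pos_bounded[OF AD(1)] by blast
  define A' where "A' x = (1 / c) *\<^sub>R A x" for x
  have "nonneg_selfadjoint A'"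
    unfolding nonneg_selfadjoint_def A'_def
    using c(1) AD by (auto intro: bounded_linear_const_scaleR)
  moreover have "norm (A' x) \<le> norm x" for x
    using c by (simp add: A'_def field_simps)
  ultimately obtain S where S: "nonneg_selfadjoint S" "S \<circ> S = A'"
    and comm: "\<And>R. bounded_linear R \<Longrightarrow> R \<circ> A' = A' \<circ> R \<Longrightarrow> R \<circ> S = S \<circ> R"
    using sqrt_contraction_exists by blast
  note SD = nonneg_selfadjointD[OF S(1)]
  define T where "T x = sqrt c *\<^sub>R S x" for x
  have "nonneg_selfadjoint T"
    unfolding nonneg_selfadjoint_def T_def
    using c(1) SD by (auto intro: bounded_linear_const_scaleR)
  moreover have "T (T x) = A x" for x
  proof -
    have "T (T x) = c *\<^sub>R S (S x)"
      using c(1) by (simp add: T_def linear_scale[OF SD(2)])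
    also have "S (S x) = A' x"
      using S(2) by (metis comp_apply)
    finally show ?thesis
      using c(1) by (simp add: A'_def)
  qed
  moreover have "R (T x) = T (R x)" if R: "bounded_linear R" "R \<circ> A = A \<circ> R" for R x
  proof -
    have "R (A u) = A (R u)" for u
      using R(2) by (metis comp_apply)
    then have "R \<circ> A' = A' \<circ> R"
      by (simp add: fun_eq_iff A'_def linear_scale[OF bounded_linear.linear[OF R(1)]])
    then have "R (S x) = S (R x)"
      using comm[OF R(1)] by (metis comp_apply)
    then show ?thesis
      by (simp add: T_def linear_scale[OF bounded_linear.linear[OF R(1)]])
  qed
  ultimately show ?thesis
    by (intro exI[of _ T]) (auto simp: fun_eq_iff)
qed

section \<open>Uniqueness of square roots\<close>

lemma nonneg_selfadjoint_eq_0: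
  assumes A: "nonneg_selfadjoint A" and "inner (A x) x = 0"
  shows "A x = 0"
proof -
  obtain c where "c > 0" "\<And>x. norm (A x) \<le> norm x * c"
    using bounded_linear.pos_bounded[OF nonneg_selfadjointD(1)[OF A]] by blast
  then show ?thesis
    using nonneg_selfadjoint_norm_sq_le[OF A, of c x] assms(2) by (simp add: mult.commute)
qed

text \<open>For \<open>y = S x - R x\<close> commutation gives
  \<open>S y + R y = S (S x) - R (R x) = 0\<close>. Nonnegativity then kills \<open>S y\<close> and
  \<open>R y\<close> separately, and symmetry turns \<open>inner y y\<close> into an expression in
  these two.\<close>

lemma commuting_nonneg_selfadjoint_sqrt_unique:
  assumes S: "nonneg_selfadjoint S" and R: "nonneg_selfadjoint R"
    and eq: "S \<circ> S = R \<circ> R" and comm: "R \<circ> S = S \<circ> R"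
  shows "S = R"
proof
  fix x
  note SD = nonneg_selfadjointD[OF S] and RD = nonneg_selfadjointD[OF R]
  define y where "y = S x - R x"
  have eq': "S (S u) = R (R u)" and comm': "R (S u) = S (R u)" for u
    using eq comm by (metis comp_apply)+
  have "S y + R y = 0"
    by (simp add: y_def linear_diff[OF SD(2)] linear_diff[OF RD(2)] eq' comm')
  then have "inner (S y) y + inner (R y) y = 0"
    by (metis inner_add_left inner_zero_left)
  then have "inner (S y) y = 0" "inner (R y) y = 0"
    using SD(4)[of y] RD(4)[of y] by linarith+
  then have "S y = 0" "R y = 0"
    using nonneg_selfadjoint_eq_0 S R by blast+
  then have "inner y y = 0"
    by (subst (2) y_def) (simp add: inner_diff_right SD(3)[symmetric] RD(3)[symmetric])
  then show "S x = R x"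
    by (simp add: y_def)
qed

section \<open>Bounded operators on complex Hilbert spaces\<close>
lemma cinner_add_right: "cinner x (y + z) = cinner x y + cinner x z"
  by (metis cinner_add_left cinner_commute complex_cnj_add)

lemma cinner_scaleC_right: "cinner x (c *\<^sub>C y) = cnj c * cinner x y"
  using cinner_commute[of x "c *\<^sub>C y"] cinner_commute[of x y] by (simp add: cinner_scaleC_left)

lemma norm_scaleC: "norm (c *\<^sub>C x) = cmod c * norm x"
proof -
  have "complex_of_real ((norm (c *\<^sub>C x))\<^sup>2) = complex_of_real ((cmod c * norm x)\<^sup>2)"
    by (simp only: cinner_self[symmetric] cinner_scaleC_left cinner_scaleC_right power_mult_distrib
        of_real_mult complex_norm_square mult_ac)
  then have "(norm (c *\<^sub>C x))\<^sup>2 = (cmod c * norm x)\<^sup>2"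
    by (simp only: of_real_eq_iff)
  then show ?thesis by simp
qed

lemma bounded_linear_scaleC: "bounded_linear (\<lambda>x :: 'a::complex_inner. c *\<^sub>C x)"
proof (rule bounded_linear_intro[of _ "cmod c"])
  show "c *\<^sub>C r *\<^sub>R x = r *\<^sub>R c *\<^sub>C x" for r and x :: 'a
    by (simp only: scaleC_of_real[symmetric] scaleC_scaleC mult.commute)
qed (simp_all add: scaleC_add_right norm_scaleC mult.commute)

lemma Im_cinner: "Im (cinner x y) = inner x (\<i> *\<^sub>C y)"
  by (simp add: inner_eq_Re_cinner cinner_scaleC_right)

lemma cinner_eqI:
  assumes "\<And>y. inner x y = inner x' (y :: 'a::complex_inner)"
  shows "x = x'"
  using assms[of "x - x'"] by (metis eq_iff_diff_eq_0 inner_diff_left inner_eq_zero_iff)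

text \<open>Over the complex numbers positivity forces symmetry, by polarisation at
  \<open>x + \<i> *\<^sub>C y\<close>. Conversely, symmetry of the real inner product at
  \<open>x\<close> and \<open>\<i> *\<^sub>C x\<close> makes \<open>cinner (T x) x\<close>
  real.\<close>

lemma positive_op_iff:
  "positive_op T \<longleftrightarrow> bounded_clinear T \<and> nonneg_selfadjoint T"
proof (intro iffI conjI)
  assume T: "positive_op T"
  then show bT: "bounded_clinear T"
    by (simp add: positive_op_def)
  have Im: "Im (cinner (T x) x) = 0" and Re: "0 \<le> inner (T x) x" for x
    using T by (auto simp: positive_op_def complex_nonneg_Reals_iff inner_eq_Re_cinner)
  have add: "T (x + y) = T x + T y" and scale: "T (c *\<^sub>C x) = c *\<^sub>C T x" for x y c
    using bT by (auto simp: bounded_clinear_def linear_add bounded_linear.linear)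
  have "inner (T x) y = inner x (T y)" for x y
  proof -
    have "Im (cinner (T (x + \<i> *\<^sub>C y)) (x + \<i> *\<^sub>C y)) = inner (T y) x - inner (T x) y"
      using Im[of x] Im[of y]
      by (simp add: add scale cinner_add_left cinner_add_right cinner_scaleC_left
          cinner_scaleC_right inner_eq_Re_cinner)
    then show ?thesis
      using Im[of "x + \<i> *\<^sub>C y"] by (simp add: inner_commute)
  qed
  then show "nonneg_selfadjoint T"
    using bT Re by (simp add: nonneg_selfadjoint_def bounded_clinear_def)
next
  assume T: "bounded_clinear T \<and> nonneg_selfadjoint T"
  then have bT: "bounded_clinear T" and TD: "nonneg_selfadjoint T" by auto
  have "Im (cinner (T x) x) = 0" for x
  proof -
    have "inner (T x) (\<i> *\<^sub>C x) = inner x (\<i> *\<^sub>C T x)"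
      using nonneg_selfadjointD(3)[OF TD, of x "\<i> *\<^sub>C x"] bT by (simp add: bounded_clinear_def)
    then have "Im (cinner (T x) x) = Im (cinner x (T x))"
      by (simp add: Im_cinner)
    then show ?thesis
      using cinner_commute[of x "T x"] by simp
  qed
  then show "positive_op T"
    using bT nonneg_selfadjointD(4)[OF TD]
    by (auto simp: positive_op_def complex_nonneg_Reals_iff inner_eq_Re_cinner)
qed

text \<open>The constructed root commutes with all bounded real-linear maps that commute with
  \<open>A\<close>. Scalar multiplications are such maps, whence complex linearity; so is any other
  positive root \<open>R\<close>, since \<open>A = R \<circ> R\<close>, whence uniqueness.\<close>

lemma op_sqrt:
  fixes A :: "'a::chilbert_space \<Rightarrow> 'a"
  assumes "positive_op A"
  shows positive_op_op_sqrt: "positive_op (op_sqrt A)"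
    and op_sqrt_comp_self: "op_sqrt A \<circ> op_sqrt A = A"
proof -
  have A: "bounded_clinear A" "nonneg_selfadjoint A"
    using assms by (auto simp: positive_op_iff)
  then obtain S where S: "nonneg_selfadjoint S" "S \<circ> S = A"
    and comm: "\<And>R. bounded_linear R \<Longrightarrow> R \<circ> A = A \<circ> R \<Longrightarrow> R \<circ> S = S \<circ> R"
    using nonneg_selfadjoint_sqrt_exists by blast
  have "S (c *\<^sub>C x) = c *\<^sub>C S x" for c x
  proof -
    have "(*\<^sub>C) c \<circ> A = A \<circ> (*\<^sub>C) c"
      using A(1) by (auto simp: bounded_clinear_def)
    then show ?thesis
      using comm[OF bounded_linear_scaleC] by (metis comp_apply)
  qed
  then have pS: "positive_op S"
    using S(1) by (simp add: positive_op_iff bounded_clinear_def nonneg_selfadjointD)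
  have "R = S" if R: "positive_op R \<and> R \<circ> R = A" for R
  proof -
    have Rn: "nonneg_selfadjoint R"
      using R by (simp add: positive_op_iff)
    have "R \<circ> S = S \<circ> R"
      using R by (intro comm nonneg_selfadjointD(1)[OF Rn]) (metis comp_assoc)
    then show ?thesis
      using commuting_nonneg_selfadjoint_sqrt_unique[OF S(1) Rn] S(2) R by simp
  qed
  then have "positive_op (op_sqrt A) \<and> op_sqrt A \<circ> op_sqrt A = A"
    unfolding op_sqrt_def by (rule theI[where P = "\<lambda>R. positive_op R \<and> R \<circ> R = A", OF conjI[OF pS S(2)]])
  then show "positive_op (op_sqrt A)" "op_sqrt A \<circ> op_sqrt A = A"
    by auto
qed

text \<open>The real representation handles real parts; replacing \<open>x\<close> by
  \<open>\<i> *\<^sub>C x\<close> transfers it to imaginary parts.\<close>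

lemma complex_riesz_along:
  fixes S :: "'a::complex_inner \<Rightarrow> 'b::chilbert_space"
    and T :: "'a \<Rightarrow> 'c::complex_inner"
  assumes S: "bounded_clinear S" and T: "bounded_clinear T"
    and le: "\<And>x. norm (T x) \<le> c * norm (S x)"
  shows "\<exists>z. \<forall>x. cinner (T x) y = cinner (S x) z"
proof -
  have lin: "linear S" "linear T"
    using S T by (auto simp: bounded_clinear_def bounded_linear.linear)
  have "\<exists>z. \<forall>x. inner (T x) y = inner (S x) z"
  proof (rule riesz_along[OF lin(1)])
    show "linear (\<lambda>x. inner (T x) y)"
      by (simp add: linear_iff linear_add[OF lin(2)] linear_scale[OF lin(2)] inner_add_left)
    show "inner (T x) y \<le> (c * norm y) * norm (S x)" for x
      using norm_cauchy_schwarz[of "T x" y] mult_right_mono[OF le[of x] norm_ge_zero[of y]]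
      by (simp add: mult_ac)
  qed
  then obtain z where z: "\<And>x. inner (T x) y = inner (S x) z"
    by blast
  have "cinner (T x) y = cinner (S x) z" for x
  proof (rule complex_eqI)
    show "Re (cinner (T x) y) = Re (cinner (S x) z)"
      using z[of x] by (simp add: inner_eq_Re_cinner)
    show "Im (cinner (T x) y) = Im (cinner (S x) z)"
      using z[of "\<i> *\<^sub>C x"] S T
      by (simp add: inner_eq_Re_cinner bounded_clinear_def cinner_scaleC_left)
  qed
  then show ?thesis by blast
qed

section \<open>Adjoints and their ranges\<close>

lemma cadjoint_eqI:
  fixes T :: "'a::complex_inner \<Rightarrow> 'b::complex_inner"
  assumes adj: "\<And>x y. cinner (T x) y = cinner x (S y)"
  shows "cadjoint T = S"
  unfolding cadjoint_def
proof (rule the_equality)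
  fix S' assume S': "\<forall>x y. cinner (T x) y = cinner x (S' y)"
  have "S' y = S y" for y
  proof (rule cinner_eqI)
    fix x
    have "inner x (S' y) = inner x (S y)"
      using S'[rule_format, of x y] adj[of x y] by (simp add: inner_eq_Re_cinner)
    then show "inner (S' y) x = inner (S y) x"
      by (simp only: inner_commute)
  qed
  then show "S' = S" by blast
qed (use adj in simp)

text \<open>Existence of the adjoint is the representation along the identity, where the required
  domination is the boundedness of \<open>T\<close>.\<close>

lemma cinner_cadjoint:
  fixes T :: "'a::chilbert_space \<Rightarrow> 'b::complex_inner"
  assumes T: "bounded_clinear T"
  shows "cinner (T x) y = cinner x (cadjoint T y)"
proof -
  have id: "bounded_clinear (id :: 'a \<Rightarrow> 'a)"
    by (simp add: bounded_clinear_def bounded_linear_ident id_def)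
  obtain K where "\<And>x. norm (T x) \<le> K * norm (id x)"
    using T bounded_linear.bounded[of T] by (auto simp: bounded_clinear_def mult.commute)
  then have "\<forall>y. \<exists>z. \<forall>x. cinner (T x) y = cinner (id x) z"
    using complex_riesz_along[OF id T] by blast
  then obtain S where S: "\<And>x y. cinner (T x) y = cinner x (S y)"
    by (metis id_apply)
  with cadjoint_eqI[of T S] show ?thesis by simp
qed

lemma cadjoint_positive_op:
  assumes "positive_op S"
  shows "cadjoint S = S"
proof (rule cadjoint_eqI)
  have S: "bounded_clinear S" "nonneg_selfadjoint S"
    using assms by (auto simp: positive_op_iff)
  have sym: "inner (S x) y = inner x (S y)" for x y
    by (rule nonneg_selfadjointD(3)[OF S(2)])
  show "cinner (S x) y = cinner x (S y)" for x y
  proof (rule complex_eqI)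
    show "Re (cinner (S x) y) = Re (cinner x (S y))"
      using sym[of x y] by (simp add: inner_eq_Re_cinner)
    show "Im (cinner (S x) y) = Im (cinner x (S y))"
      using sym[of x "\<i> *\<^sub>C y"] S(1) by (simp add: Im_cinner bounded_clinear_def)
  qed
qed

text \<open>Inclusion of the ranges means that each functional
  \<open>\<lambda>x. cinner (T x) y\<close> equals \<open>\<lambda>x. cinner (S x) z\<close> for
  some \<open>z\<close>. The codomains of \<open>S\<close> and \<open>T\<close> may differ, as they
  do for the frame.\<close>

theorem douglas_range_inclusion:
  fixes S :: "'a::chilbert_space \<Rightarrow> 'b::chilbert_space" and T :: "'a \<Rightarrow> 'c::chilbert_space"
  assumes S: "bounded_clinear S" and T: "bounded_clinear T"
  shows "range (cadjoint T) \<subseteq> range (cadjoint S) \<longleftrightarrow> (\<exists>c>0. \<forall>x. norm (T x) \<le> c * norm (S x))"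
proof
  assume sub: "range (cadjoint T) \<subseteq> range (cadjoint S)"
  have lin: "linear S" "linear T"
    using S T by (auto simp: bounded_clinear_def bounded_linear.linear)
  have dual: "\<exists>z. \<forall>x. inner (T x) y = inner (S x) z" for y
  proof -
    obtain z where "cadjoint T y = cadjoint S z"
      using sub by blast
    then show ?thesis
      by (metis cinner_cadjoint[OF S] cinner_cadjoint[OF T] inner_eq_Re_cinner)
  qed
  have "bounded (T ` {x. norm (S x) \<le> 1})"
  proof (rule weakly_bounded_imp_bounded)
    fix y
    obtain z where z: "\<And>x. inner (T x) y = inner (S x) z"
      using dual by blast
    have "\<bar>inner (T x) y\<bar> \<le> norm z" if "norm (S x) \<le> 1" for x
      using Cauchy_Schwarz_ineq2[of "S x" z] mult_right_mono[OF that norm_ge_zero[of z]]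
      by (simp add: z)
    then show "\<exists>M. \<forall>v\<in>T ` {x. norm (S x) \<le> 1}. \<bar>inner v y\<bar> \<le> M"
      by blast
  qed
  then obtain c where c: "c > 0" and le1: "\<And>x. norm (S x) \<le> 1 \<Longrightarrow> norm (T x) \<le> c"
    by (auto simp: bounded_pos)
  have "norm (T x) \<le> c * norm (S x)" for x
  proof (cases "S x = 0")
    case True
    \<comment> \<open>Rescaling is impossible here; duality at \<open>y = T x\<close> forces
      \<open>T x = 0\<close>.\<close>
    obtain z where "inner (T x) (T x) = inner (S x) z"
      using dual by blast
    then show ?thesis using True by simp
  next
    case False
    then have "norm (T ((1 / norm (S x)) *\<^sub>R x)) \<le> c"
      by (intro le1) (simp add: linear_scale[OF lin(1)])
    then show ?thesis
      using False by (simp add: linear_scale[OF lin(2)] field_simps)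
  qed
  with c show "\<exists>c>0. \<forall>x. norm (T x) \<le> c * norm (S x)" by blast
next
  assume "\<exists>c>0. \<forall>x. norm (T x) \<le> c * norm (S x)"
  then obtain c where c: "\<And>x. norm (T x) \<le> c * norm (S x)" by blast
  show "range (cadjoint T) \<subseteq> range (cadjoint S)"
  proof
    fix w assume "w \<in> range (cadjoint T)"
    then obtain y where w: "w = cadjoint T y" by blast
    obtain z where z: "\<And>x. cinner (T x) y = cinner (S x) z"
      using complex_riesz_along[OF S T c] by blast
    have "cadjoint T y = cadjoint S z"
    proof (rule cinner_eqI)
      show "inner (cadjoint T y) x = inner (cadjoint S z) x" for x
        using z[of x] cinner_cadjoint[OF S, of x z] cinner_cadjoint[OF T, of x y]
        by (metis inner_commute inner_eq_Re_cinner)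
    qed
    then show "w \<in> range (cadjoint S)"
      using w by blast
  qed
qed

section \<open>Frames\<close>
lemma op_norm_eq_norm_op_sqrt:
  fixes A :: "'a::chilbert_space \<Rightarrow> 'a"
  assumes "positive_op A"
  shows "op_norm A x = norm (op_sqrt A x)"
proof -
  have S: "nonneg_selfadjoint (op_sqrt A)"
    using positive_op_op_sqrt[OF assms] by (simp add: positive_op_iff)
  have "A x = op_sqrt A (op_sqrt A x)"
    using op_sqrt_comp_self[OF assms] by (metis comp_apply)
  then have "inner (A x) x = inner (op_sqrt A x) (op_sqrt A x)"
    using nonneg_selfadjointD(3)[OF S] by simp
  then show ?thesis
    by (simp add: op_norm_def op_inner_def inner_eq_Re_cinner[symmetric] norm_eq_sqrt_inner)
qed

text \<open>Full domain guarantees that \<open>Abs_ell2\<close> is applied only to square-summable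
  sequences, so linearity can be checked coordinatewise.\<close>

lemma analysis_op_linear:
  assumes A: "positive_op A" and dom: "analysis_dom A F = UNIV"
  shows analysis_op_add: "analysis_op A F (f + g) = analysis_op A F f + analysis_op A F g"
    and analysis_op_scaleC: "analysis_op A F (c *\<^sub>C f) = c *\<^sub>C analysis_op A F f"
proof -
  have nth: "ell2_nth (analysis_op A F h) n = op_inner A h (F n)" for h n
    using dom by (subst analysis_op_def, subst ell2_nth_Abs) (auto simp: analysis_dom_def)
  have "bounded_linear A" "\<And>c x. A (c *\<^sub>C x) = c *\<^sub>C A x"
    using A by (auto simp: positive_op_def bounded_clinear_def)
  then show "analysis_op A F (f + g) = analysis_op A F f + analysis_op A F g"
    "analysis_op A F (c *\<^sub>C f) = c *\<^sub>C analysis_op A F f"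
    by (auto intro!: ell2_eqI simp: nth nth_ell2 op_inner_def linear_add bounded_linear.linear cinner_add_left
        cinner_scaleC_left)
qed

theorem theorem4p21:
  fixes A :: "'a::chilbert_space \<Rightarrow> 'a"
    and B :: "ell2 \<Rightarrow> ell2"
    and F :: "nat \<Rightarrow> 'a"
  assumes "positive_op A"
    and "positive_op B"
  shows "AB_frame A B F \<longleftrightarrow>
    analysis_dom A F = UNIV \<and>
    bounded_clinear (op_sqrt B \<circ> analysis_op A F) \<and>
    range (cadjoint (op_sqrt B \<circ> analysis_op A F)) = range (op_sqrt A)"
proof -
  define S where "S = op_sqrt A"
  define T where "T = op_sqrt B \<circ> analysis_op A F"
  have pS: "positive_op S" and bS: "bounded_clinear S"
    using positive_op_op_sqrt[OF assms(1)] by (auto simp: S_def positive_op_def)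
  have frame: "AB_frame A B F \<longleftrightarrow> analysis_dom A F = UNIV \<and>
      (\<exists>\<alpha>>0. \<exists>\<beta>>0. \<forall>f. \<alpha> * (norm (S f))\<^sup>2 \<le> (norm (T f))\<^sup>2 \<and> (norm (T f))\<^sup>2 \<le> \<beta> * (norm (S f))\<^sup>2)"
    by (simp add: AB_frame_def op_norm_eq_norm_op_sqrt assms S_def T_def)
  \<comment> \<open>\<open>S\<close> is its own adjoint, so equality of the ranges is Douglas' lemma
    applied in both directions.\<close>
  have range_eq: "range (cadjoint T) = range S \<longleftrightarrow>
      (\<exists>c>0. \<forall>f. norm (S f) \<le> c * norm (T f)) \<and> (\<exists>c>0. \<forall>f. norm (T f) \<le> c * norm (S f))"
    if "bounded_clinear T"
    using douglas_range_inclusion[OF bS that] douglas_range_inclusion[OF that bS] cadjoint_positive_op[OF pS] by auto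
  show ?thesis
    unfolding frame S_def[symmetric] T_def[symmetric]
  proof (intro iffI conjI; (elim conjE exE)?)
    fix \<alpha> \<beta> :: real
    assume dom: "analysis_dom A F = UNIV" and ab: "\<alpha> > 0" "\<beta> > 0"
      and le: "\<forall>f. \<alpha> * (norm (S f))\<^sup>2 \<le> (norm (T f))\<^sup>2 \<and> (norm (T f))\<^sup>2 \<le> \<beta> * (norm (S f))\<^sup>2"
    have S_le: "norm (S f) \<le> (1 / sqrt \<alpha>) * norm (T f)" for f
    proof -
      have "norm (S f) * sqrt \<alpha> \<le> norm (T f)"
        by (rule power2_le_imp_le) (use le ab in \<open>simp_all add: power_mult_distrib mult.commute\<close>)
      then show ?thesis
        using ab by (simp add: field_simps)
    qed
    have T_le: "norm (T f) \<le> sqrt \<beta> * norm (S f)" for f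
      by (rule power2_le_imp_le) (use le ab in \<open>simp_all add: power_mult_distrib\<close>)
    have bB: "bounded_linear (op_sqrt B)" "\<And>c x. op_sqrt B (c *\<^sub>C x) = c *\<^sub>C op_sqrt B x"
      using positive_op_op_sqrt[OF assms(2)] by (auto simp: positive_op_def bounded_clinear_def)
    have add: "T (f + g) = T f + T g" and scale: "T (c *\<^sub>C f) = c *\<^sub>C T f" for f g c
      by (simp_all add: T_def analysis_op_linear[OF assms(1) dom] linear_add[OF bounded_linear.linear[OF bB(1)]] bB(2))
    obtain K where K: "\<And>f. norm (S f) \<le> norm f * K"
      using bS bounded_linear.bounded[of S] by (auto simp: bounded_clinear_def)
    \<comment> \<open>Boundedness comes from the upper frame bound combined with the boundedness of
      \<open>S\<close>.\<close>
    have "bounded_linear T"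
    proof (rule bounded_linear_intro)
      show "T (r *\<^sub>R f) = r *\<^sub>R T f" for r f
        using scale[of "complex_of_real r" f] by (simp add: scaleC_of_real)
      have "sqrt \<beta> * norm (S f) \<le> sqrt \<beta> * (norm f * K)" for f
        using ab by (intro mult_left_mono K) auto
      from order_trans[OF T_le this]
      show "norm (T f) \<le> norm f * (K * sqrt \<beta>)" for f
        by (simp only: mult_ac)
    qed (rule add)
    then show bT: "bounded_clinear T"
      by (simp add: bounded_clinear_def scale)
    show "range (cadjoint T) = range S"
      unfolding range_eq[OF bT] using S_le T_le ab
      by (intro conjI exI[of _ "1 / sqrt \<alpha>"] exI[of _ "sqrt \<beta>"]) auto
  next
    assume bT: "bounded_clinear T" and "range (cadjoint T) = range S"
    then obtain c d where cd: "c > 0" "d > 0"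
      and S_le: "\<And>f. norm (S f) \<le> c * norm (T f)" and T_le: "\<And>f. norm (T f) \<le> d * norm (S f)"
      using range_eq by auto
    \<comment> \<open>Squaring the two norm bounds yields the frame bounds
      \<open>1 / c\<^sup>2\<close> and \<open>d\<^sup>2\<close>.\<close>
    have "(1 / c\<^sup>2) * (norm (S f))\<^sup>2 \<le> (norm (T f))\<^sup>2 \<and> (norm (T f))\<^sup>2 \<le> d\<^sup>2 * (norm (S f))\<^sup>2" for f
      using power_mono[OF S_le[of f], of 2] power_mono[OF T_le[of f], of 2] cd
      by (simp add: power_mult_distrib field_simps)
    then show "\<exists>\<alpha>>0. \<exists>\<beta>>0. \<forall>f. \<alpha> * (norm (S f))\<^sup>2 \<le> (norm (T f))\<^sup>2 \<and> (norm (T f))\<^sup>2 \<le> \<beta> * (norm (S f))\<^sup>2"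
      using cd by (intro exI[of _ "1 / c\<^sup>2"] exI[of _ "d\<^sup>2"] conjI) auto
  qed
qed

end
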